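(* Let $(X,d_X,\leq_{P_1})$ and $(Y,d_Y,\leq_{P_2})$ be two partially ordered complete metric spaces and let $F:X\times Y\rightarrow X$, $G:Y\times X\rightarrow Y$ be two mappings (not assumed continuous) having the mixed monotone property. Assume that $X$ and $Y$ have the following properties: (i) if a non-decreasing sequence $\{x_j\}$ in $X$ converges to $x\in X$, then $x_j\leq_{P_1} x$ for all $j$; (ii) if a non-increasing sequence $\{y_j\}$ in $Y$ converges to $y\in Y$, then $y\leq_{P_2} y_j$ for all $j$. Also assume that there exist $k,l,m,n\in \left[0,\frac{1}{2}\right)$ satisfying $$d_X(F(x,y),F(u,v))\leq k\, d_X(x,F(x,y))+l\, d_X(u, F(u,v))\quad \text{for all } x,u\in X,\ y,v\in Y \text{ with } x\geq_{P_1}u,\ y\leq_{P_2}v,$$ $$d_Y(G(y,x),G(v,u))\leq m\, d_Y(y,G(y,x))+n\, d_Y(v,G(v,u))\quad \text{for all } x,u\in X,\ y,v\in Y \text{ with } x\leq_{P_1}u,\ y\geq_{P_2}v.$$ If there exist $x_0\in X$, $y_0\in Y$ satisfying $x_0\leq_{P_1} F(x_0, y_0)$ and $y_0\geq_{P_2} G(y_0, x_0)$, then there exist $x\in X$, $y\in Y$ such that $x=F(x,y)$ and $y=G(y,x)$.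
   Context: A partially ordered complete metric space $(X,d_X,\leq_{P_1})$ is a set $X$ with a metric $d_X$ for which it is complete and a partial order $\leq_{P_1}$ (no compatibility between them is assumed beyond what is stated). The maps $F:X\times Y\to X$ and $G:Y\times X\to Y$ have the mixed monotone property if for all $x\in X$, $y\in Y$: for all $x_1,x_2\in X$, $x_1\leq_{P_1} x_2$ implies $F(x_1,y)\leq_{P_1} F(x_2,y)$ and $G(y,x_1)\geq_{P_2}G(y,x_2)$; and for all $y_1,y_2\in Y$, $y_1\leq_{P_2}y_2$ implies $F(x,y_1)\geq_{P_1}F(x,y_2)$ and $G(y_1,x)\leq_{P_2}G(y_2,x)$. *)

theory Defs
  imports "HOL-Analysis.Analysis"
begin

definition mixed_monotone ::
    "('a::order \<Rightarrow> 'b::order \<Rightarrow> 'a) \<Rightarrow> ('b \<Rightarrow> 'a \<Rightarrow> 'b) \<Rightarrow> bool" where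
  "mixed_monotone F G \<longleftrightarrow>
     (\<forall>x y.
        (\<forall>x1 x2. x1 \<le> x2 \<longrightarrow> F x1 y \<le> F x2 y \<and> G y x1 \<ge> G y x2) \<and>
        (\<forall>y1 y2. y1 \<le> y2 \<longrightarrow> F x y1 \<ge> F x y2 \<and> G y1 x \<le> G y2 x))"

end

theory Submission
  imports Defs
begin

text \<open>
  Iterating \<open>(x, y) \<mapsto> (F x y, G y x)\<close> from \<open>(x0, y0)\<close> gives an increasing and a decreasing
  sequence, so consecutive iterates are comparable and each sequence satisfies a scalar Kannan
  estimate by itself; the two coordinates interact only through the order. The iterates are
  therefore Cauchy, and the order conditions on limits let the Kannan inequality be
  applied to an iterate and the limit, which replaces continuity of \<open>F\<close> and \<open>G\<close>.
\<close>

text \<open>Telescoping bounds the distance from index \<open>i\<close> to any later index by a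
  geometric tail, which tends to 0 as \<open>i\<close> grows.\<close>

lemma Cauchy_if_dist_Suc_le_geometric:
  fixes s :: "nat \<Rightarrow> 'a::metric_space"
  assumes "0 \<le> q" "q < 1"
    and step: "\<And>j. dist (s j) (s (Suc j)) \<le> C * q ^ j"
  shows "Cauchy s"
proof -
  have tail: "dist (s i) (s j) \<le> C * q ^ i / (1 - q)" if "i \<le> j" for i j
  proof -
    have C: "0 \<le> C"
      using step[of 0] zero_le_dist[of "s 0" "s (Suc 0)"] by (simp del: zero_le_dist)
    \<comment> \<open>The exact partial sum makes the induction go through; the term
      \<open>q ^ j\<close> is dropped only afterwards, using \<open>0 \<le> C\<close>.\<close>
    have "dist (s i) (s j) \<le> C * (q ^ i - q ^ j) / (1 - q)"
      using that
    proof (induction j rule: dec_induct)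
      case base
      then show ?case by simp
    next
      case (step j)
      have "dist (s i) (s (Suc j)) \<le> dist (s i) (s j) + dist (s j) (s (Suc j))"
        by (rule dist_triangle)
      also have "\<dots> \<le> C * (q ^ i - q ^ j) / (1 - q) + C * q ^ j"
        using step.IH assms(3) by (rule add_mono)
      also have "\<dots> = C * (q ^ i - q ^ Suc j) / (1 - q)"
        using \<open>q < 1\<close> by (simp add: field_simps)
      finally show ?case .
    qed
    also have "\<dots> \<le> C * q ^ i / (1 - q)"
      using C assms(1,2) by (intro divide_right_mono mult_left_mono) auto
    finally show ?thesis .
  qed
  have lim: "(\<lambda>i. C * q ^ i / (1 - q)) \<longlonglongrightarrow> 0"
    using assms(1,2) by (auto intro!: tendsto_divide_zero tendsto_mult_right_zero LIMSEQ_power_zero)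
  show ?thesis
    unfolding Cauchy_altdef2
  proof (intro allI impI)
    fix e :: real assume "e > 0"
    with lim have "\<forall>\<^sub>F i in sequentially. C * q ^ i / (1 - q) < e"
      by (rule order_tendstoD)
    then obtain N where "C * q ^ N / (1 - q) < e"
      by (auto simp: eventually_sequentially)
    then show "\<exists>N. \<forall>n\<ge>N. dist (s n) (s N) < e"
      using tail by (metis dist_commute order.strict_trans1)
  qed
qed

text \<open>Absorbing the \<open>a\<close> term into the left side makes consecutive distances
  shrink by the factor \<open>b / (1 - a)\<close>, which is below 1 because
  \<open>a + b < 1\<close>.\<close>

lemma Cauchy_if_Kannan_step:
  fixes s :: "nat \<Rightarrow> 'a::metric_space"
  assumes "0 \<le> b" "a + b < 1" "a < 1"
    and step: "\<And>j. dist (s (Suc j)) (s (Suc (Suc j)))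
                 \<le> a * dist (s (Suc j)) (s (Suc (Suc j))) + b * dist (s j) (s (Suc j))"
  shows "Cauchy s"
proof (rule Cauchy_if_dist_Suc_le_geometric)
  let ?q = "b / (1 - a)"
  show q: "0 \<le> ?q" "?q < 1"
    using assms(1-3) by (auto simp: field_simps)
  show "dist (s j) (s (Suc j)) \<le> dist (s 0) (s (Suc 0)) * ?q ^ j" for j
  proof (induction j)
    case (Suc j)
    have "dist (s (Suc j)) (s (Suc (Suc j))) \<le> ?q * dist (s j) (s (Suc j))"
      using step[of j] \<open>a < 1\<close> by (simp add: field_simps)
    also have "\<dots> \<le> ?q * (dist (s 0) (s (Suc 0)) * ?q ^ j)"
      using Suc q(1) by (rule mult_left_mono)
    finally show ?case by (simp add: mult_ac)
  qed simp
qed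

text \<open>As \<open>j\<close> grows, the consecutive distances vanish and the estimate becomes
  \<open>dist p z \<le> a * dist z p\<close>, which forces distance 0 since
  \<open>a < 1\<close>.\<close>

lemma limit_eq_if_Kannan_step:
  fixes s :: "nat \<Rightarrow> 'a::metric_space"
  assumes "a < 1" and lim: "s \<longlonglongrightarrow> z"
    and step: "\<And>j. dist p (s (Suc j)) \<le> a * dist z p + b * dist (s j) (s (Suc j))"
  shows "z = p"
proof -
  have "(\<lambda>j. dist p (s (Suc j))) \<longlonglongrightarrow> dist p z"
    by (intro tendsto_intros LIMSEQ_Suc lim)
  moreover have "(\<lambda>j. a * dist z p + b * dist (s j) (s (Suc j)))
      \<longlonglongrightarrow> a * dist z p + b * dist z z"
    by (intro tendsto_intros LIMSEQ_Suc lim)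
  ultimately have "dist p z \<le> a * dist z p + b * dist z z"
    using step by (intro LIMSEQ_le) auto
  then have "(1 - a) * dist z p \<le> 0"
    by (simp add: dist_commute algebra_simps)
  with \<open>a < 1\<close> show ?thesis
    by (simp add: mult_le_0_iff)
qed

theorem theorem2p5:
  fixes F :: "'a::{complete_space, order} \<Rightarrow> 'b::{complete_space, order} \<Rightarrow> 'a"
    and G :: "'b \<Rightarrow> 'a \<Rightarrow> 'b"
    and k l m n :: real
  assumes "mixed_monotone F G"
    and "\<And>(s :: nat \<Rightarrow> 'a) x. incseq s \<Longrightarrow> s \<longlonglongrightarrow> x \<Longrightarrow> (\<forall>j. s j \<le> x)"
    and "\<And>(s :: nat \<Rightarrow> 'b) y. decseq s \<Longrightarrow> s \<longlonglongrightarrow> y \<Longrightarrow> (\<forall>j. y \<le> s j)"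
    and "k \<in> {0..<1/2}" "l \<in> {0..<1/2}" "m \<in> {0..<1/2}" "n \<in> {0..<1/2}"
    and "\<And>x u y v. x \<ge> u \<Longrightarrow> y \<le> v \<Longrightarrow>
           dist (F x y) (F u v) \<le> k * dist x (F x y) + l * dist u (F u v)"
    and "\<And>x u y v. x \<le> u \<Longrightarrow> y \<ge> v \<Longrightarrow>
           dist (G y x) (G v u) \<le> m * dist y (G y x) + n * dist v (G v u)"
    and "\<exists>x0 y0. x0 \<le> F x0 y0 \<and> y0 \<ge> G y0 x0"
  shows "\<exists>x y. x = F x y \<and> y = G y x"
proof -
  note mm = assms(1)[unfolded mixed_monotone_def, rule_format]
  note F_Kannan = assms(8) and G_Kannan = assms(9)
  obtain x0 y0 where start: "x0 \<le> F x0 y0" "G y0 x0 \<le> y0"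
    using assms(10) by blast
  \<comment> \<open>Each coordinate of the iteration depends on both, so the recursion runs on
    pairs.\<close>
  define p where "p = rec_nat (x0, y0) (\<lambda>_ (x, y). (F x y, G y x))"
  define s where "s j = fst (p j)" for j
  define t where "t j = snd (p j)" for j
  have init: "s 0 = x0" "t 0 = y0"
    and s_Suc: "s (Suc j) = F (s j) (t j)" and t_Suc: "t (Suc j) = G (t j) (s j)" for j
    by (simp_all add: s_def t_def p_def split_beta)
  have mono: "s j \<le> s (Suc j) \<and> t (Suc j) \<le> t j" for j
  proof (induction j)
    case 0
    then show ?case using start by (simp add: s_Suc t_Suc init)
  next
    case (Suc j)
    \<comment> \<open>Raising the first argument and lowering the second both increase
      \<open>F\<close>; changing one argument at a time and chaining gives the claim.\<close>
    have "F (s j) (t j) \<le> F (s (Suc j)) (t (Suc j))"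
      using mm Suc by (meson order_trans)
    moreover have "G (t (Suc j)) (s (Suc j)) \<le> G (t j) (s j)"
      using mm Suc by (meson order_trans)
    ultimately show ?case by (simp only: s_Suc t_Suc)
  qed
  have "incseq s" "decseq t"
    using mono by (auto intro: incseq_SucI decseq_SucI)
  have "Cauchy s"
  proof (rule Cauchy_if_Kannan_step)
    \<comment> \<open>The later iterate is the larger one and takes the first slot of the
      inequality, so \<open>k\<close> is the coefficient to absorb.\<close>
    show "dist (s (Suc j)) (s (Suc (Suc j)))
        \<le> k * dist (s (Suc j)) (s (Suc (Suc j))) + l * dist (s j) (s (Suc j))" for j
      using F_Kannan[of "s j" "s (Suc j)" "t (Suc j)" "t j"] mono[of j]
      by (simp add: s_Suc[symmetric] dist_commute)
  qed (use assms(4,5) in auto)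
  then obtain x where x: "s \<longlonglongrightarrow> x"
    using Cauchy_convergent_iff convergent_def by blast
  have "Cauchy t"
  proof (rule Cauchy_if_Kannan_step)
    \<comment> \<open>Since \<open>t\<close> decreases, the later iterate now takes the second slot,
      and \<open>n\<close> is absorbed instead of \<open>m\<close>.\<close>
    show "dist (t (Suc j)) (t (Suc (Suc j)))
        \<le> n * dist (t (Suc j)) (t (Suc (Suc j))) + m * dist (t j) (t (Suc j))" for j
      using G_Kannan[of "s j" "s (Suc j)" "t (Suc j)" "t j"] mono[of j]
      by (simp add: t_Suc[symmetric] add.commute)
  qed (use assms(6,7) in auto)
  then obtain y where y: "t \<longlonglongrightarrow> y"
    using Cauchy_convergent_iff convergent_def by blast
  have s_le: "s j \<le> x" and t_ge: "y \<le> t j" for j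
    using assms(2)[OF \<open>incseq s\<close> x] assms(3)[OF \<open>decseq t\<close> y] by auto
  have "x = F x y"
  proof (rule limit_eq_if_Kannan_step)
    \<comment> \<open>The limit pair dominates every iterate (\<open>s j \<le> x\<close>,
      \<open>y \<le> t j\<close>), so it takes the first slot and \<open>k\<close> multiplies the
      distance to be shown zero.\<close>
    show "dist (F x y) (s (Suc j)) \<le> k * dist x (F x y) + l * dist (s j) (s (Suc j))" for j
      using F_Kannan[OF s_le t_ge, of j j] by (simp add: s_Suc)
  qed (use assms(4) x in auto)
  moreover have "y = G y x"
  proof (rule limit_eq_if_Kannan_step)
    \<comment> \<open>Here the limit pair takes the second slot, which is why \<open>n\<close> plays
      the part of \<open>k\<close>.\<close>
    show "dist (G y x) (t (Suc j)) \<le> n * dist y (G y x) + m * dist (t j) (t (Suc j))" for j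
      using G_Kannan[OF s_le t_ge, of j j] by (simp add: t_Suc dist_commute add.commute)
  qed (use assms(7) y in auto)
  ultimately show ?thesis by blast
qed

end
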